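(* Let $q$ be a prime power, let $n$ be a positive integer with $\gcd(n,q)=1$, and let $\xi$ be a primitive $n$-th root of unity in an algebraic closure $\overline{\mathbb{F}}_q$ of $\mathbb{F}_q$. Let $\beta_1,\beta_2\in\overline{\mathbb{F}}_q$ satisfy $\beta_1^n,\beta_2^n\in\mathbb{F}_q^*$. For $i=1,2$ let $\mathcal{C}_i\subseteq\mathbb{F}_q^n$ be a $\beta_i^n$-constacyclic code with complete generating set $\mathcal{G}_i\subseteq\mathbb{Z}_n$ with respect to $\xi$ and $\beta_i$. Then the complete generating set of the $(\beta_1\beta_2)^n$-constacyclic code $\mathcal{C}_1\circ\mathcal{C}_2$ with respect to $\xi$ and $\beta_1\beta_2$ is the sumset $\mathcal{G}_1+\mathcal{G}_2=\{a+b: a\in\mathcal{G}_1,\ b\in\mathcal{G}_2\}$.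
   Context: Vectors $(a_0,\ldots,a_{n-1})\in\mathbb{F}_q^n$ are identified with polynomials $\sum_{i=0}^{n-1}a_ix^i$. For $\lambda\in\mathbb{F}_q^*$, a $\lambda$-constacyclic code of length $n$ is (under this identification) an ideal of $\mathbb{F}_q[x]/\langle x^n-\lambda\rangle$; it is generated by a unique monic polynomial $g(x)$ dividing $x^n-\lambda$, called its generator polynomial. If $\beta^n=\lambda$, the complete generating set of $\mathcal{C}=\langle g(x)\rangle$ with respect to $\xi,\beta$ is $\{i\in\mathbb{Z}_n: g(\xi^i\beta)\neq 0\}$. The Schur product of vectors is the component-wise product, and for codes $\mathcal{C}_1\circ\mathcal{C}_2=\operatorname{span}_{\mathbb{F}_q}\{\mathbf{c}_1\circ\mathbf{c}_2:\mathbf{c}_1\in\mathcal{C}_1,\mathbf{c}_2\in\mathcal{C}_2\}$. The Schur product of a $\lambda_1$-constacyclic code and a $\lambda_2$-constacyclic code is $\lambda_1\lambda_2$-constacyclic. *)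

theory Defs
  imports
    "HOL-Algebra.Algebraic_Closure_Type"
    "HOL-Algebra.QuotRing"
    "HOL-Library.Cardinality"
    "Jordan_Normal_Form.VS_Connect"
begin

unbundle no fps_syntax

definition vec_poly :: "'a::comm_ring_1 vec \<Rightarrow> 'a poly"
  where "vec_poly v = (\<Sum>i<dim_vec v. Polynomial.monom (v $ i) i)"

definition constacyclic_modulus :: "nat \<Rightarrow> 'a::comm_ring_1 \<Rightarrow> 'a poly"
  where "constacyclic_modulus n lam = Polynomial.monom 1 n - [:lam:]"

definition constacyclic_ideal :: "nat \<Rightarrow> 'a::comm_ring_1 \<Rightarrow> 'a poly set"
  where "constacyclic_ideal n lam =
    PIdl\<^bsub>ring_of_type_algebra\<^esub> (constacyclic_modulus n lam)"

text \<open>The ring of polynomials modulo \<open>x ^ n - lam\<close>; its elements are cosets.\<close>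

definition constacyclic_ring :: "nat \<Rightarrow> 'a::comm_ring_1 \<Rightarrow> 'a poly set ring"
  where "constacyclic_ring n lam = ring_of_type_algebra Quot constacyclic_ideal n lam"

definition residue_class :: "nat \<Rightarrow> 'a::comm_ring_1 \<Rightarrow> 'a poly \<Rightarrow> 'a poly set"
  where "residue_class n lam p = constacyclic_ideal n lam +>\<^bsub>ring_of_type_algebra\<^esub> p"

text \<open>For \<open>n > 0\<close>, a vector of length \<open>n\<close> is identified with the class of its polynomial. This map
  is a bijection from \<open>carrier_vec n\<close> onto the quotient ring, since every class has exactly one
  representative of degree less than \<open>n\<close>.\<close>

definition code_classes :: "nat \<Rightarrow> 'a::comm_ring_1 \<Rightarrow> 'a vec set \<Rightarrow> 'a poly set set"
  where "code_classes n lam C = (\<lambda>c. residue_class n lam (vec_poly c)) ` C"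

definition constacyclic_code :: "nat \<Rightarrow> 'a::field \<Rightarrow> 'a vec set \<Rightarrow> bool"
  where "constacyclic_code n lam C \<longleftrightarrow>
    C \<subseteq> carrier_vec n \<and> ideal (code_classes n lam C) (constacyclic_ring n lam)"

definition is_generator_polynomial :: "nat \<Rightarrow> 'a::field \<Rightarrow> 'a vec set \<Rightarrow> 'a poly \<Rightarrow> bool"
  where "is_generator_polynomial n lam C g \<longleftrightarrow>
    Polynomial.lead_coeff g = 1 \<and> g dvd constacyclic_modulus n lam \<and>
    code_classes n lam C = Idl\<^bsub>constacyclic_ring n lam\<^esub> {residue_class n lam g}"

definition generator_polynomial :: "nat \<Rightarrow> 'a::field \<Rightarrow> 'a vec set \<Rightarrow> 'a poly"
  where "generator_polynomial n lam C = (THE g. is_generator_polynomial n lam C g)"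

definition primitive_root_of_unity :: "nat \<Rightarrow> 'a::field \<Rightarrow> bool"
  where "primitive_root_of_unity n \<xi> \<longleftrightarrow> \<xi> ^ n = 1 \<and> (\<forall>k. 0 < k \<and> k < n \<longrightarrow> \<xi> ^ k \<noteq> 1)"

text \<open>Elements of \<open>\<int>\<^sub>n\<close> are represented by their least nonnegative residues. The parameter \<open>lam\<close> is
  meant to satisfy \<open>\<beta> ^ n = to_ac lam\<close>.\<close>

definition complete_generating_set ::
    "nat \<Rightarrow> 'a::field \<Rightarrow> 'a alg_closure \<Rightarrow> 'a alg_closure \<Rightarrow> 'a vec set \<Rightarrow> nat set"
  where "complete_generating_set n lam \<xi> \<beta> C =
    {i. i < n \<and> poly (map_poly to_ac (generator_polynomial n lam C)) (\<xi> ^ i * \<beta>) \<noteq> 0}"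

definition sumset_mod :: "nat \<Rightarrow> nat set \<Rightarrow> nat set \<Rightarrow> nat set"
  where "sumset_mod n A B = {(a + b) mod n | a b. a \<in> A \<and> b \<in> B}"

definition schur_vec :: "'a::times vec \<Rightarrow> 'a vec \<Rightarrow> 'a vec"
  where "schur_vec u v = vec (dim_vec u) (\<lambda>i. u $ i * v $ i)"

definition schur_code :: "nat \<Rightarrow> 'a::field vec set \<Rightarrow> 'a vec set \<Rightarrow> 'a vec set"
  where "schur_code n C D =
    LinearCombinations.module.span class_ring (module_vec TYPE('a) n)
      {schur_vec c d | c d. c \<in> C \<and> d \<in> D}"

end

theory Submission
  imports Defs "HOL-Number_Theory.Residues"
begin

text \<open>An index \<open>i\<close> belongs to the complete generating set of \<open>C\<close> exactly when some codeword, read as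
  a polynomial, does not vanish at \<open>\<xi> ^ i * \<beta>\<close>. By Fourier inversion over the \<open>n\<close>-th roots of
  \<open>\<beta>\<^sub>1 ^ n\<close>, the codeword \<open>c\<close> is a combination of geometric vectors with ratios
  \<open>1 / (\<xi> ^ a * \<beta>\<^sub>1)\<close> and weights \<open>c(\<xi> ^ a * \<beta>\<^sub>1) / n\<close>, so that
  \<open>n * (c \<circ> d)(x) = (\<Sum>a<n. c(\<xi> ^ a * \<beta>\<^sub>1) * d(x / (\<xi> ^ a * \<beta>\<^sub>1)))\<close>. A nonzero value on the left at
  \<open>x = \<xi> ^ i * \<beta>\<^sub>1 * \<beta>\<^sub>2\<close> therefore splits \<open>i\<close> as a sum. Conversely, the geometric vectors that occur
  in \<open>c\<close> are combinations of constacyclic shifts of \<open>c\<close> over the algebraic closure, so no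
  cancellation can affect all the shifts at once.\<close>

section \<open>Vectors as polynomials, and the constacyclic shift\<close>

lemma coeff_vec_poly:
  "Polynomial.coeff (vec_poly v) i = (if i < dim_vec v then v $ i else 0)"
proof -
  have "Polynomial.coeff (vec_poly v) i = (\<Sum>j<dim_vec v. if j = i then v $ j else 0)"
    unfolding vec_poly_def by (simp add: coeff_sum)
  then show ?thesis by simp
qed

lemma degree_vec_poly_less: "0 < dim_vec v \<Longrightarrow> Polynomial.degree (vec_poly v) < dim_vec v"
  by (rule degree_lessI) (auto simp: coeff_vec_poly)

lemma vec_poly_zero [simp]: "vec_poly (0\<^sub>v n) = 0"
  by (rule poly_eqI) (simp add: coeff_vec_poly)

lemma vec_poly_add: "dim_vec u = dim_vec v \<Longrightarrow> vec_poly (u + v) = vec_poly u + vec_poly v"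
  by (rule poly_eqI) (simp add: coeff_vec_poly)

lemma vec_poly_smult: "vec_poly (a \<cdot>\<^sub>v v) = [:a:] * vec_poly v"
  by (rule poly_eqI) (simp add: coeff_vec_poly)

text \<open>Multiplication by \<open>x\<close> modulo \<open>x ^ n - lam\<close>, carried out on
  coefficient vectors.\<close>

definition constacyclic_shift :: "'a::comm_ring_1 \<Rightarrow> 'a vec \<Rightarrow> 'a vec"
  where "constacyclic_shift lam v =
    vec (dim_vec v) (\<lambda>i. if i = 0 then lam * v $ (dim_vec v - 1) else v $ (i - 1))"

lemma dim_constacyclic_shift [simp]: "dim_vec (constacyclic_shift lam v) = dim_vec v"
  by (simp add: constacyclic_shift_def)

lemma constacyclic_shift_carrier [simp]:
  "v \<in> carrier_vec n \<Longrightarrow> constacyclic_shift lam v \<in> carrier_vec n"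
  by (rule carrier_vecI) simp

lemma coeff_constacyclic_modulus:
  "Polynomial.coeff (constacyclic_modulus n lam) i =
    (if i = n then 1 else 0) - (if i = 0 then lam else 0)"
  by (cases i) (auto simp: constacyclic_modulus_def)

text \<open>Multiplying by \<open>x\<close> pushes only the last entry up to degree
  \<open>n\<close>. Subtracting that entry times \<open>x ^ n - lam\<close> brings it back to index
  0 with the factor \<open>lam\<close>.\<close>

lemma vec_poly_constacyclic_shift:
  assumes "n > 0" "v \<in> carrier_vec n"
  shows "pCons 0 (vec_poly v) =
    vec_poly (constacyclic_shift lam v) + [:v $ (n - 1):] * constacyclic_modulus n lam"
proof (rule poly_eqI)
  fix i
  have dim: "dim_vec v = n" using assms by simp
  have shift: "Polynomial.coeff (vec_poly (constacyclic_shift lam v)) i =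
    (if i < n then if i = 0 then lam * v $ (n - 1) else v $ (i - 1) else 0)"
    by (simp add: coeff_vec_poly dim) (simp add: constacyclic_shift_def dim)
  have modulus: "Polynomial.coeff ([:v $ (n - 1):] * constacyclic_modulus n lam) i =
    v $ (n - 1) * ((if i = n then 1 else 0) - (if i = 0 then lam else 0))"
    by (simp add: coeff_constacyclic_modulus)
  show "Polynomial.coeff (pCons 0 (vec_poly v)) i = Polynomial.coeff
    (vec_poly (constacyclic_shift lam v) + [:v $ (n - 1):] * constacyclic_modulus n lam) i"
    unfolding Polynomial.coeff_add shift modulus
    using assms(1) by (cases i) (auto simp: coeff_vec_poly dim not_less less_Suc_eq_le le_Suc_eq)
qed

lemma degree_constacyclic_modulus:
  "n > 0 \<Longrightarrow> Polynomial.degree (constacyclic_modulus n (lam :: 'a::field)) = n"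
  unfolding constacyclic_modulus_def
  using degree_add_eq_left[of "- [:lam:]" "Polynomial.monom 1 n"]
  unfolding diff_conv_add_uminus by (simp add: degree_monom_eq)

lemma constacyclic_modulus_nonzero:
  "n > 0 \<Longrightarrow> constacyclic_modulus n (lam :: 'a::field) \<noteq> 0"
  using degree_constacyclic_modulus[of n lam] by auto

text \<open>A nonzero multiple of the modulus has degree at least \<open>n\<close>, while the
  difference has degree below \<open>n\<close>. Hence a vector is determined by its residue
  class.\<close>

lemma constacyclic_modulus_dvd_vec_poly_diff:
  fixes lam :: "'a::field"
  assumes "n > 0" "u \<in> carrier_vec n" "v \<in> carrier_vec n"
    and dvd: "constacyclic_modulus n lam dvd vec_poly u - vec_poly v"
  shows "u = v"
proof -
  have "Polynomial.degree (vec_poly u - vec_poly v) < n"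
    using assms degree_vec_poly_less[of u] degree_vec_poly_less[of v]
    by (intro degree_diff_less) auto
  then have "vec_poly u - vec_poly v = 0"
    using dvd_imp_degree_le[OF dvd] degree_constacyclic_modulus[OF assms(1), of lam]
    by (cases "vec_poly u - vec_poly v = 0") auto
  then have coeff_eq: "Polynomial.coeff (vec_poly u) i = Polynomial.coeff (vec_poly v) i" for i
    by simp
  show ?thesis
  proof (rule eq_vecI)
    show "u $ i = v $ i" if "i < dim_vec v" for i
      using coeff_eq[of i] that assms(2,3) by (simp add: coeff_vec_poly)
  qed (use assms(2,3) in simp)
qed

section \<open>The quotient ring by \<open>x ^ n - lam\<close> and its residue classes\<close>

lemma ring_of_type_algebra_simps [simp]:
  "carrier ring_of_type_algebra = UNIV"
  "x \<otimes>\<^bsub>ring_of_type_algebra\<^esub> y = x * y"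
  "x \<oplus>\<^bsub>ring_of_type_algebra\<^esub> y = x + y"
  "\<one>\<^bsub>ring_of_type_algebra\<^esub> = 1"
  "\<zero>\<^bsub>ring_of_type_algebra\<^esub> = 0"
  by (simp_all add: ring_of_type_algebra_def)

lemma mem_constacyclic_ideal_iff:
  "p \<in> constacyclic_ideal n lam \<longleftrightarrow> constacyclic_modulus n lam dvd p"
  by (auto simp: constacyclic_ideal_def cgenideal_def dvd_def mult.commute)

lemma ideal_constacyclic_ideal: "ideal (constacyclic_ideal n lam) ring_of_type_algebra"
  unfolding constacyclic_ideal_def
  by (intro cring.cgenideal_ideal cring_from_type_algebra) simp

lemma ring_hom_residue_class:
  "ring_hom_cring ring_of_type_algebra (constacyclic_ring n lam) (residue_class n lam)"
proof -
  interpret ideal "constacyclic_ideal n lam" ring_of_type_algebra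
    by (rule ideal_constacyclic_ideal)
  show ?thesis
    unfolding constacyclic_ring_def residue_class_def
    by (rule rcos_ring_hom_cring) (rule cring_from_type_algebra)
qed

lemma cring_constacyclic_ring: "cring (constacyclic_ring n lam)"
  using ring_hom_residue_class ring_hom_cring_def by blast

lemma carrier_constacyclic_ring: "carrier (constacyclic_ring n lam) = range (residue_class n lam)"
  by (auto simp: constacyclic_ring_def residue_class_def FactRing_def A_RCOSETS_def')

lemma residue_class_add:
  "residue_class n lam (p + q) =
    residue_class n lam p \<oplus>\<^bsub>constacyclic_ring n lam\<^esub> residue_class n lam q"
  using ring_hom_add[OF ring_hom_cring.homh[OF ring_hom_residue_class[of n lam]], of p q] by simp

lemma residue_class_mult:
  "residue_class n lam (p * q) =
    residue_class n lam p \<otimes>\<^bsub>constacyclic_ring n lam\<^esub> residue_class n lam q"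
  using ring_hom_mult[OF ring_hom_cring.homh[OF ring_hom_residue_class[of n lam]], of p q] by simp

lemma residue_class_zero: "residue_class n lam 0 = \<zero>\<^bsub>constacyclic_ring n lam\<^esub>"
  using ring_hom_cring.hom_zero[OF ring_hom_residue_class[of n lam]] by simp

lemma residue_class_eq_iff:
  "residue_class n lam p = residue_class n lam q \<longleftrightarrow> constacyclic_modulus n lam dvd p - q"
proof -
  have mem: "r \<in> residue_class n lam s \<longleftrightarrow> constacyclic_modulus n lam dvd r - s" for r s
    unfolding residue_class_def a_r_coset_def' mem_constacyclic_ideal_iff[symmetric]
    by (auto intro!: bexI[of _ "r - s"])
  show ?thesis
  proof
    assume "residue_class n lam p = residue_class n lam q"
    then show "constacyclic_modulus n lam dvd p - q"
      using mem[of p p] mem[of p q] by simp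
  next
    assume pq: "constacyclic_modulus n lam dvd p - q"
    have "constacyclic_modulus n lam dvd r - p \<longleftrightarrow> constacyclic_modulus n lam dvd r - q" for r
      using dvd_add_left_iff[OF pq, of "r - p"] by simp
    then show "residue_class n lam p = residue_class n lam q"
      using mem by blast
  qed
qed

section \<open>Codes as shift-invariant subspaces\<close>

lemma residue_class_constacyclic_shift:
  assumes "n > 0" "v \<in> carrier_vec n"
  shows "residue_class n lam (vec_poly (constacyclic_shift lam v)) =
    residue_class n lam (pCons 0 (vec_poly v))"
  unfolding residue_class_eq_iff vec_poly_constacyclic_shift[OF assms, of lam]
  by (simp add: dvd_smult)

text \<open>Since \<open>code_classes\<close> is an image, membership of a class only provides some
  codeword with that class. Injectivity of the identification shows that this codeword is
  \<open>v\<close>.\<close>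

lemma residue_class_vec_poly_mem_iff:
  fixes lam :: "'a::field"
  assumes "n > 0" "C \<subseteq> carrier_vec n" "v \<in> carrier_vec n"
  shows "residue_class n lam (vec_poly v) \<in> code_classes n lam C \<longleftrightarrow> v \<in> C"
proof
  assume "residue_class n lam (vec_poly v) \<in> code_classes n lam C"
  then obtain c where "c \<in> C" "constacyclic_modulus n lam dvd vec_poly v - vec_poly c"
    by (auto simp: code_classes_def residue_class_eq_iff)
  then show "v \<in> C"
    using constacyclic_modulus_dvd_vec_poly_diff[OF assms(1), of v c lam] assms(2,3) by auto
qed (auto simp: code_classes_def)

text \<open>Multiplication by constants is scaling and multiplication by \<open>x\<close> is the
  shift; together with sums these produce multiplication by every polynomial. The arguments about
  shifts and Schur products use these closure conditions in place of the quotient ring.\<close>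

lemma constacyclic_code_iff:
  fixes lam :: "'a::field"
  assumes n: "n > 0"
  shows "constacyclic_code n lam C \<longleftrightarrow>
    C \<subseteq> carrier_vec n \<and> 0\<^sub>v n \<in> C \<and> (\<forall>u\<in>C. \<forall>v\<in>C. u + v \<in> C) \<and>
    (\<forall>a. \<forall>v\<in>C. a \<cdot>\<^sub>v v \<in> C) \<and> (\<forall>v\<in>C. constacyclic_shift lam v \<in> C)"
    (is "_ \<longleftrightarrow> ?rhs")
proof
  assume C: "constacyclic_code n lam C"
  then have sub: "C \<subseteq> carrier_vec n"
    and "ideal (code_classes n lam C) (constacyclic_ring n lam)"
    by (auto simp: constacyclic_code_def)
  then interpret ideal "code_classes n lam C" "constacyclic_ring n lam" by simp
  note mem = residue_class_vec_poly_mem_iff[OF n sub, where lam = lam]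
  have in_classes: "residue_class n lam (vec_poly v) \<in> code_classes n lam C" if "v \<in> C" for v
    using that by (auto simp: code_classes_def)
  have dim: "v \<in> carrier_vec n" "dim_vec v = n" if "v \<in> C" for v
    using sub that by auto
  have mult: "residue_class n lam (p * vec_poly v) \<in> code_classes n lam C" if "v \<in> C" for p v
    unfolding residue_class_mult
    using I_l_closed[OF in_classes[OF that], of "residue_class n lam p"]
    by (auto simp: carrier_constacyclic_ring)
  have "0\<^sub>v n \<in> C"
    using mem[of "0\<^sub>v n"] additive_subgroup.zero_closed[OF is_additive_subgroup]
    by (simp add: residue_class_zero)
  moreover have "u + v \<in> C" if "u \<in> C" "v \<in> C" for u v
    using mem[of "u + v"] dim that in_classes
    by (simp add: vec_poly_add residue_class_add)
  moreover have "a \<cdot>\<^sub>v v \<in> C" if "v \<in> C" for a v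
    using mem[of "a \<cdot>\<^sub>v v"] dim that mult[OF that, of "[:a:]"] by (simp add: vec_poly_smult)
  moreover have "constacyclic_shift lam v \<in> C" if "v \<in> C" for v
    using mem[of "constacyclic_shift lam v"] dim that mult[OF that, of "[:0, 1:]"]
    by (simp add: residue_class_constacyclic_shift[OF n])
  ultimately show ?rhs using sub by auto
next
  assume rhs: ?rhs
  then have sub: "C \<subseteq> carrier_vec n" by simp
  interpret R: cring "constacyclic_ring n lam" by (rule cring_constacyclic_ring)
  have dim: "v \<in> carrier_vec n" "dim_vec v = n" if "v \<in> C" for v
    using sub that by auto
  have add: "x \<oplus>\<^bsub>constacyclic_ring n lam\<^esub> y \<in> code_classes n lam C"
    if xy: "x \<in> code_classes n lam C" "y \<in> code_classes n lam C" for x y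
  proof -
    obtain u v where uv: "u \<in> C" "v \<in> C"
      and "x = residue_class n lam (vec_poly u)" "y = residue_class n lam (vec_poly v)"
      using xy by (auto simp: code_classes_def)
    then have "x \<oplus>\<^bsub>constacyclic_ring n lam\<^esub> y = residue_class n lam (vec_poly (u + v))"
      using dim(2)[OF uv(1)] dim(2)[OF uv(2)] by (simp add: vec_poly_add residue_class_add)
    then show ?thesis using rhs uv by (auto simp: code_classes_def)
  qed
  \<comment> \<open>Horner's scheme: \<open>pCons a p\<close> times \<open>v\<close> is
    \<open>a * v\<close> plus \<open>p\<close> times \<open>x * v\<close>, and \<open>x * v\<close>
    has the class of the shifted vector. The induction hypothesis is applied to that shift, so
    \<open>v\<close> has to vary.\<close>
  have mult: "residue_class n lam (p * vec_poly v) \<in> code_classes n lam C" if "v \<in> C" for p v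
    using that
  proof (induction p arbitrary: v)
    case 0
    have "residue_class n lam (vec_poly (0\<^sub>v n)) \<in> code_classes n lam C"
      using rhs unfolding code_classes_def by blast
    then show ?case by simp
  next
    case (pCons a p)
    have v: "v \<in> carrier_vec n" using dim pCons.prems by auto
    have "a \<cdot>\<^sub>v v \<in> C" "constacyclic_shift lam v \<in> C" using rhs pCons.prems by auto
    then have "residue_class n lam (vec_poly (a \<cdot>\<^sub>v v)) \<in> code_classes n lam C"
      and "residue_class n lam (p * vec_poly (constacyclic_shift lam v)) \<in> code_classes n lam C"
      using pCons.IH by (auto simp: code_classes_def)
    then have "residue_class n lam (vec_poly (a \<cdot>\<^sub>v v)) \<oplus>\<^bsub>constacyclic_ring n lam\<^esub>
        residue_class n lam (p * vec_poly (constacyclic_shift lam v)) \<in> code_classes n lam C"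
      by (rule add)
    also have "residue_class n lam (p * vec_poly (constacyclic_shift lam v)) =
        residue_class n lam (p * pCons 0 (vec_poly v))"
      unfolding residue_class_mult residue_class_constacyclic_shift[OF n v] ..
    finally show ?case
      by (simp add: residue_class_add[symmetric] vec_poly_smult)
  qed
  have closed: "y \<otimes>\<^bsub>constacyclic_ring n lam\<^esub> x \<in> code_classes n lam C"
    if "x \<in> code_classes n lam C" "y \<in> carrier (constacyclic_ring n lam)" for x y
    using that mult by (auto simp: code_classes_def carrier_constacyclic_ring residue_class_mult)
  have carrier: "code_classes n lam C \<subseteq> carrier (constacyclic_ring n lam)"
    by (auto simp: code_classes_def carrier_constacyclic_ring)
  have zero: "\<zero>\<^bsub>constacyclic_ring n lam\<^esub> \<in> code_classes n lam C"
    using rhs unfolding code_classes_def residue_class_zero[symmetric]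
    by (intro image_eqI[of _ _ "0\<^sub>v n"]) auto
  have "ideal (code_classes n lam C) (constacyclic_ring n lam)"
  proof (rule idealI)
    show "ring (constacyclic_ring n lam)" by (rule R.ring_axioms)
    show "subgroup (code_classes n lam C) (add_monoid (constacyclic_ring n lam))"
    proof (rule R.add.subgroupI)
      show "code_classes n lam C \<noteq> {}" using zero by auto
      fix x assume x: "x \<in> code_classes n lam C"
      have "\<ominus>\<^bsub>constacyclic_ring n lam\<^esub> x =
          (\<ominus>\<^bsub>constacyclic_ring n lam\<^esub> \<one>\<^bsub>constacyclic_ring n lam\<^esub>) \<otimes>\<^bsub>constacyclic_ring n lam\<^esub> x"
        using x carrier by (simp add: R.l_minus subset_iff)
      then show "\<ominus>\<^bsub>constacyclic_ring n lam\<^esub> x \<in> code_classes n lam C"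
        using closed[OF x] by simp
    qed (use carrier add in auto)
    fix x y assume *: "x \<in> code_classes n lam C" "y \<in> carrier (constacyclic_ring n lam)"
    then show "y \<otimes>\<^bsub>constacyclic_ring n lam\<^esub> x \<in> code_classes n lam C" by (rule closed)
    then show "x \<otimes>\<^bsub>constacyclic_ring n lam\<^esub> y \<in> code_classes n lam C"
      using * carrier by (simp add: R.m_comm subset_iff)
  qed
  then show "constacyclic_code n lam C" using sub by (simp add: constacyclic_code_def)
qed

section \<open>Generator polynomials\<close>

lemma Idl_residue_class:
  "Idl\<^bsub>constacyclic_ring n lam\<^esub> {residue_class n lam g} = (\<lambda>p. residue_class n lam (p * g)) ` UNIV"
proof -
  interpret R: cring "constacyclic_ring n lam" by (rule cring_constacyclic_ring)
  have "residue_class n lam g \<in> carrier (constacyclic_ring n lam)"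
    by (auto simp: carrier_constacyclic_ring)
  from R.cgenideal_eq_genideal[OF this, symmetric] show ?thesis
    by (auto simp: cgenideal_def carrier_constacyclic_ring residue_class_mult)
qed

text \<open>Each of the two is a multiple of the other modulo \<open>x ^ n - lam\<close>. As both
  divide the modulus, they divide each other outright, and associated monic polynomials
  coincide.\<close>

lemma generator_polynomial_unique:
  assumes "is_generator_polynomial n lam C g" "is_generator_polynomial n lam C h"
  shows "g = h"
proof -
  have dvd: "h dvd g"
    if "is_generator_polynomial n lam C g" "is_generator_polynomial n lam C h" for g h
  proof -
    have "residue_class n lam g = residue_class n lam (1 * g)" by simp
    also have "\<dots> \<in> code_classes n lam C"
      using that(1) unfolding is_generator_polynomial_def Idl_residue_class by blast
    also have "\<dots> = (\<lambda>p. residue_class n lam (p * h)) ` UNIV"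
      using that(2) unfolding is_generator_polynomial_def Idl_residue_class by blast
    finally obtain p where "constacyclic_modulus n lam dvd g - p * h"
      by (auto simp: residue_class_eq_iff)
    moreover have "h dvd constacyclic_modulus n lam"
      using that(2) by (simp add: is_generator_polynomial_def)
    ultimately have "h dvd g - p * h" by (rule dvd_trans[rotated])
    then show ?thesis by (simp add: dvd_diff_left_iff)
  qed
  obtain a where a: "g = h * a" using dvd[OF assms] by (rule dvdE)
  obtain b where b: "h = g * b" using dvd[OF assms(2,1)] by (rule dvdE)
  have lead: "Polynomial.lead_coeff g = 1" "Polynomial.lead_coeff h = 1"
    using assms by (auto simp: is_generator_polynomial_def)
  then have "g \<noteq> 0" by auto
  moreover have "g * (a * b) = g * 1" using a b by (metis mult.assoc mult.commute mult.right_neutral)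
  ultimately have "a dvd 1" by (metis dvd_triv_left mult_left_cancel)
  then obtain c where c: "a = [:c:]" by (auto simp: is_unit_poly_iff)
  then have "c = 1" using lead a by (simp add: lead_coeff_mult del: mult_pCons_right)
  then show ?thesis using a c by simp
qed

text \<open>The polynomials whose class lies in the code form an ideal of the polynomial ring, and a
  monic polynomial of least degree in it is the generator.\<close>

lemma ex_generator_polynomial:
  fixes lam :: "'a::field"
  assumes n: "n > 0" and C: "constacyclic_code n lam C"
  shows "\<exists>g. is_generator_polynomial n lam C g"
proof -
  let ?M = "constacyclic_modulus n lam"
  define J where "J = {p. residue_class n lam p \<in> code_classes n lam C}"
  interpret ideal "code_classes n lam C" "constacyclic_ring n lam"
    using C by (simp add: constacyclic_code_def)
  have J_mult: "p * q \<in> J" if "q \<in> J" for p q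
    using I_l_closed[of "residue_class n lam q" "residue_class n lam p"] that
    by (auto simp: J_def residue_class_mult carrier_constacyclic_ring)
  have J_add: "p + q \<in> J" if "p \<in> J" "q \<in> J" for p q
    using that by (simp add: J_def residue_class_add)
  have J_M: "?M \<in> J"
  proof -
    have "residue_class n lam ?M = residue_class n lam 0" by (simp add: residue_class_eq_iff)
    then show ?thesis by (simp add: J_def residue_class_zero)
  qed
  \<comment> \<open>The modulus is itself a nonzero element of \<open>J\<close>, so there is a
    nonzero element of least degree.\<close>
  obtain g where g: "g \<in> J" "g \<noteq> 0"
    and min: "\<And>h. h \<in> J \<Longrightarrow> h \<noteq> 0 \<Longrightarrow> Polynomial.degree g \<le> Polynomial.degree h"
    using ex_has_least_nat[of "\<lambda>p. p \<in> J \<and> p \<noteq> 0" ?M Polynomial.degree]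
      J_M constacyclic_modulus_nonzero[OF n, of lam] by auto
  have dvd: "g dvd h" if h: "h \<in> J" for h
  proof -
    have "h mod g = h + (- (h div g)) * g" by (simp add: minus_mult_div_eq_mod[symmetric])
    then have "h mod g \<in> J" using J_add[OF h J_mult[OF g(1)]] by metis
    then have "h mod g = 0"
      using min[of "h mod g"] degree_mod_less[OF g(2), of h] by force
    then show ?thesis by auto
  qed
  define f where "f = [:inverse (Polynomial.lead_coeff g):] * g"
  have f_J: "f \<in> J" unfolding f_def by (rule J_mult) (rule g(1))
  have f_dvd: "f dvd h" if "h \<in> J" for h
    using dvd[OF that] g(2) by (simp add: f_def smult_dvd_iff)
  have "code_classes n lam C = (\<lambda>p. residue_class n lam (p * f)) ` UNIV"
  proof (intro equalityI subsetI)
    fix x assume x: "x \<in> code_classes n lam C"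
    then obtain p where p: "x = residue_class n lam p" unfolding code_classes_def by blast
    with x have "f dvd p" by (intro f_dvd) (simp add: J_def)
    then show "x \<in> (\<lambda>p. residue_class n lam (p * f)) ` UNIV"
      using p by (auto simp: dvd_def mult.commute)
  next
    fix x assume "x \<in> (\<lambda>p. residue_class n lam (p * f)) ` UNIV"
    then show "x \<in> code_classes n lam C" using J_mult[OF f_J] by (auto simp: J_def)
  qed
  then have "is_generator_polynomial n lam C f"
    unfolding is_generator_polynomial_def Idl_residue_class
    using f_dvd[OF J_M] g(2) by (simp add: f_def)
  then show ?thesis ..
qed

lemma is_generator_polynomial_generator_polynomial:
  fixes lam :: "'a::field"
  assumes "n > 0" "constacyclic_code n lam C"
  shows "is_generator_polynomial n lam C (generator_polynomial n lam C)"
  unfolding generator_polynomial_def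
  using ex_generator_polynomial[OF assms] generator_polynomial_unique
  by (blast intro!: theI'[of "is_generator_polynomial n lam C"])

section \<open>Evaluation at roots of \<open>x ^ n - lam\<close> in the algebraic closure\<close>

lemma poly_map_to_ac_add:
  "poly (map_poly to_ac (p + q)) x = poly (map_poly to_ac p) x + poly (map_poly to_ac q) x"
proof -
  have "map_poly to_ac (p + q) = map_poly to_ac p + map_poly to_ac q"
    by (rule poly_eqI) (simp add: coeff_map_poly)
  then show ?thesis by simp
qed

lemma poly_map_to_ac_mult:
  "poly (map_poly to_ac (p * q)) x = poly (map_poly to_ac p) x * poly (map_poly to_ac q) x"
  by (induction p) (simp_all add: map_poly_pCons map_poly_smult poly_map_to_ac_add algebra_simps)

lemma poly_map_to_ac_diff:
  "poly (map_poly to_ac (p - q)) x = poly (map_poly to_ac p) x - poly (map_poly to_ac q) x"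
  using poly_map_to_ac_add[of "p - q" q x] by simp

definition vec_eval :: "'a::field vec \<Rightarrow> 'a alg_closure \<Rightarrow> 'a alg_closure"
  where "vec_eval v x = (\<Sum>j<dim_vec v. to_ac (v $ j) * x ^ j)"

lemma poly_map_to_ac_vec_poly: "poly (map_poly to_ac (vec_poly v)) x = vec_eval v x"
proof -
  have "poly (map_poly to_ac (sum f A)) x = (\<Sum>a\<in>A. poly (map_poly to_ac (f a)) x)"
    for f :: "nat \<Rightarrow> 'a poly" and A
    by (induction A rule: infinite_finite_induct) (simp_all add: poly_map_to_ac_add)
  then show ?thesis
    by (simp add: vec_poly_def vec_eval_def map_poly_monom poly_monom)
qed

lemma vec_eval_zero [simp]: "vec_eval (0\<^sub>v n) x = 0"
  by (simp add: vec_eval_def)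

lemma vec_eval_add: "dim_vec u = dim_vec v \<Longrightarrow> vec_eval (u + v) x = vec_eval u x + vec_eval v x"
  by (simp add: vec_eval_def algebra_simps sum.distrib)

lemma vec_eval_smult: "vec_eval (a \<cdot>\<^sub>v v) x = to_ac a * vec_eval v x"
  by (simp add: vec_eval_def algebra_simps sum_distrib_left)

lemma poly_map_to_ac_constacyclic_modulus:
  "poly (map_poly to_ac (constacyclic_modulus n lam)) x = x ^ n - to_ac lam"
  by (simp add: constacyclic_modulus_def poly_map_to_ac_diff map_poly_monom poly_monom map_poly_pCons)

text \<open>The two polynomials differ by a multiple of the modulus, which vanishes at
  \<open>x\<close>. Evaluation at such a root is thus well defined on the quotient ring.\<close>

lemma poly_map_to_ac_residue_class:
  assumes "x ^ n = to_ac lam" "residue_class n lam p = residue_class n lam q"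
  shows "poly (map_poly to_ac p) x = poly (map_poly to_ac q) x"
proof -
  obtain r where "p - q = constacyclic_modulus n lam * r"
    using assms(2) unfolding residue_class_eq_iff by (rule dvdE)
  then have "poly (map_poly to_ac (p - q)) x = 0"
    using assms(1) by (simp add: poly_map_to_ac_mult poly_map_to_ac_constacyclic_modulus)
  then show ?thesis by (simp add: poly_map_to_ac_diff)
qed

text \<open>Modulo \<open>x ^ n - lam\<close> every codeword is a multiple of the generator, so it
  vanishes wherever the generator does. Conversely, the generator has the same class as some
  codeword.\<close>

lemma generator_polynomial_nonzero_iff:
  fixes lam :: "'a::field"
  assumes n: "n > 0" and C: "constacyclic_code n lam C" and x: "x ^ n = to_ac lam"
  shows "poly (map_poly to_ac (generator_polynomial n lam C)) x \<noteq> 0 \<longleftrightarrow> (\<exists>c\<in>C. vec_eval c x \<noteq> 0)"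
proof -
  let ?g = "generator_polynomial n lam C"
  have classes: "code_classes n lam C = range (\<lambda>p. residue_class n lam (p * ?g))"
    using is_generator_polynomial_generator_polynomial[OF n C]
    by (simp add: is_generator_polynomial_def Idl_residue_class)
  have "residue_class n lam (1 * ?g) \<in> code_classes n lam C"
    unfolding classes by blast
  then obtain c where c: "c \<in> C" "residue_class n lam ?g = residue_class n lam (vec_poly c)"
    by (auto simp: code_classes_def)
  have "poly (map_poly to_ac ?g) x = vec_eval c x"
    using poly_map_to_ac_residue_class[OF x c(2)] by (simp add: poly_map_to_ac_vec_poly)
  moreover have "poly (map_poly to_ac ?g) x \<noteq> 0" if d: "d \<in> C" "vec_eval d x \<noteq> 0" for d
  proof -
    have "residue_class n lam (vec_poly d) \<in> code_classes n lam C"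
      using d by (auto simp: code_classes_def)
    then obtain p where "residue_class n lam (vec_poly d) = residue_class n lam (p * ?g)"
      unfolding classes by blast
    from poly_map_to_ac_residue_class[OF x this] d(2) show ?thesis
      by (auto simp: poly_map_to_ac_vec_poly poly_map_to_ac_mult)
  qed
  ultimately show ?thesis using c(1) by metis
qed

text \<open>Every point \<open>\<xi> ^ i * \<beta>\<close> is a root of \<open>x ^ n - lam\<close>,
  so the previous criterion applies to it. This removes the generator polynomial from the rest of
  the argument.\<close>

lemma complete_generating_set_eq:
  fixes lam :: "'a::field"
  assumes "n > 0" "constacyclic_code n lam C" "\<xi> ^ n = 1" "\<beta> ^ n = to_ac lam"
  shows "complete_generating_set n lam \<xi> \<beta> C = {i. i < n \<and> (\<exists>c\<in>C. vec_eval c (\<xi> ^ i * \<beta>) \<noteq> 0)}"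
proof -
  have "(\<xi> ^ i) ^ n = 1" for i
    using assms(3) by (metis power_mult mult.commute power_one)
  then have "(\<xi> ^ i * \<beta>) ^ n = to_ac lam" for i
    using assms(4) by (simp add: power_mult_distrib)
  then show ?thesis
    unfolding complete_generating_set_def
    using generator_polynomial_nonzero_iff[OF assms(1,2)] by simp
qed

section \<open>Infinite extensions of codewords, and their windows\<close>

definition constacyclic_sequence :: "'a::field \<Rightarrow> 'a vec \<Rightarrow> nat \<Rightarrow> 'a"
  where "constacyclic_sequence lam v m = v $ (m mod dim_vec v) / lam ^ (m div dim_vec v)"

lemma constacyclic_sequence_less:
  "m < dim_vec v \<Longrightarrow> constacyclic_sequence lam v m = v $ m"
  by (simp add: constacyclic_sequence_def)

text \<open>Passing to the next block costs one more division by \<open>lam\<close>. A geometric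
  sequence of ratio \<open>1 / x\<close> with \<open>x ^ n = lam\<close> obeys the same law, and
  this is why the extension divides instead of multiplying.\<close>

lemma constacyclic_sequence_add_dim:
  assumes "dim_vec v > 0"
  shows "constacyclic_sequence lam v (m + dim_vec v) = constacyclic_sequence lam v m / lam"
proof -
  have "(m + dim_vec v) div dim_vec v = Suc (m div dim_vec v)"
    using assms div_add_self2[of "dim_vec v" m] by linarith
  then show ?thesis by (simp add: constacyclic_sequence_def)
qed

text \<open>The window starting at \<open>n\<close> is \<open>v\<close> divided by
  \<open>lam\<close>, and each constacyclic shift moves the window one place to the left. The window
  starting at \<open>k\<close> is therefore a scalar multiple of the shift of \<open>v\<close>
  applied \<open>n - k\<close> times.\<close>

lemma constacyclic_sequence_window_mem:
  fixes lam :: "'a::field"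
  assumes n: "n > 0" and C: "constacyclic_code n lam C" and lam: "lam \<noteq> 0"
    and v: "v \<in> C" and k: "k \<le> n"
  shows "vec n (\<lambda>j. constacyclic_sequence lam v (j + k)) \<in> C"
proof -
  let ?s = "constacyclic_sequence lam v"
  have dim: "dim_vec v = n" using C v by (auto simp: constacyclic_code_def)
  have per: "?s (m + n) = ?s m / lam" for m
    using constacyclic_sequence_add_dim[of v lam m] n dim by simp
  note closed = constacyclic_code_iff[OF n, THEN iffD1, OF C]
  \<comment> \<open>The factor \<open>lam\<close> makes the case \<open>l = 0\<close> equal to
    \<open>v\<close> itself.\<close>
  have shift: "vec n (\<lambda>j. lam * ?s (j + (n - l))) \<in> C" if "l \<le> n" for l
    using that
  proof (induction l)
    case 0
    have "vec n (\<lambda>j. lam * ?s (j + (n - 0))) = v"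
      by (rule eq_vecI) (simp_all add: per lam dim constacyclic_sequence_less)
    then show ?case using v by simp
  next
    case (Suc l)
    let ?u = "vec n (\<lambda>j. lam * ?s (j + (n - l)))"
    have "vec n (\<lambda>j. lam * ?s (j + (n - Suc l))) = constacyclic_shift lam ?u"
    proof (rule eq_vecI)
      fix j assume "j < dim_vec (constacyclic_shift lam ?u)"
      then have j: "j < n" by simp
      show "vec n (\<lambda>j. lam * ?s (j + (n - Suc l))) $ j = constacyclic_shift lam ?u $ j"
      proof (cases j)
        case 0
        \<comment> \<open>The last position of the old window lies exactly \<open>n\<close> beyond
          the first position of the new one, so the factor \<open>lam\<close> of the shift cancels
          the division between blocks.\<close>
        have "n - 1 + (n - l) = (n - Suc l) + n" using Suc.prems by simp
        then have "?s (n - 1 + (n - l)) = ?s (n - Suc l) / lam" using per by metis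
        then show ?thesis using 0 n lam by (simp add: constacyclic_shift_def)
      next
        case (Suc i)
        have "Suc i + (n - Suc l) = i + (n - l)" using \<open>Suc l \<le> n\<close> by simp
        then show ?thesis using Suc j by (simp add: constacyclic_shift_def)
      qed
    qed simp
    then show ?case using Suc closed by simp
  qed
  have "vec n (\<lambda>j. ?s (j + k)) = inverse lam \<cdot>\<^sub>v vec n (\<lambda>j. lam * ?s (j + (n - (n - k))))"
    using k lam by (intro eq_vecI) simp_all
  then show ?thesis using shift[of "n - k"] closed by simp
qed

text \<open>Moving the window one step drops \<open>h j\<close> and gains \<open>h (j + n)\<close>,
  which is the same element.\<close>

lemma sum_periodic_window:
  fixes h :: "nat \<Rightarrow> 'a::ab_group_add"
  assumes "\<And>m. h (m + n) = h m"
  shows "(\<Sum>m<n. h (j + m)) = (\<Sum>m<n. h m)"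
proof (induction j)
  case (Suc j)
  have "(\<Sum>m<n. h (Suc j + m)) + h j = (\<Sum>m<Suc n. h (j + m))"
    by (subst sum.lessThan_Suc_shift) (simp add: add.commute)
  also have "\<dots> = (\<Sum>m<n. h (j + m)) + h j" using assms by simp
  finally show ?case using Suc by simp
qed simp

text \<open>The terms \<open>s m * x ^ m\<close> have period \<open>n\<close>, so their sum over a
  window does not depend on its start \<open>j\<close>. Hence the windows weighted by
  \<open>x ^ k\<close> add up to \<open>vec_eval v x\<close> times the geometric vector with entries
  \<open>1 / x ^ j\<close>.\<close>

lemma constacyclic_sequence_sum:
  assumes n: "dim_vec v > 0" and x: "x ^ dim_vec v = to_ac lam" and lam: "lam \<noteq> 0"
  shows "(\<Sum>k<dim_vec v. to_ac (constacyclic_sequence lam v (j + k)) * x ^ k) * x ^ j = vec_eval v x"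
proof -
  define h where "h m = to_ac (constacyclic_sequence lam v m) * x ^ m" for m
  have "h (m + dim_vec v) = h m" for m
    using x lam by (simp add: h_def constacyclic_sequence_add_dim[OF n] power_add)
  then have "(\<Sum>k<dim_vec v. h (j + k)) = (\<Sum>k<dim_vec v. h k)"
    by (rule sum_periodic_window)
  then show ?thesis
    by (simp add: h_def vec_eval_def constacyclic_sequence_less sum_distrib_left power_add mult_ac)
qed

lemma schur_vec_carrier [simp]: "u \<in> carrier_vec n \<Longrightarrow> schur_vec u v \<in> carrier_vec n"
  by (intro carrier_vecI) (simp add: schur_vec_def)

text \<open>Weighting the shifts of \<open>c\<close> by powers of \<open>x\<close> produces a multiple of the geometric vector
  with ratio \<open>1 / x\<close>, whose Schur product with \<open>d\<close> takes at \<open>x * y\<close> the value of \<open>d\<close> at \<open>y\<close>.\<close>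

lemma ex_schur_vec_eval_nonzero:
  fixes lam :: "'a::field"
  assumes n: "n > 0" and C: "constacyclic_code n lam C" and lam: "lam \<noteq> 0" and x: "x ^ n = to_ac lam"
    and c: "c \<in> C" "vec_eval c x \<noteq> 0" and d: "d \<in> carrier_vec n" "vec_eval d y \<noteq> 0"
  shows "\<exists>e\<in>C. vec_eval (schur_vec e d) (x * y) \<noteq> 0"
proof (rule ccontr)
  assume neg: "\<not> ?thesis"
  have dim: "dim_vec c = n" "dim_vec d = n" using C c d by (auto simp: constacyclic_code_def)
  let ?s = "constacyclic_sequence lam c"
  have zero: "(\<Sum>j<n. to_ac (?s (j + k)) * to_ac (d $ j) * (x * y) ^ j) = 0" if "k < n" for k
  proof -
    have "vec n (\<lambda>j. ?s (j + k)) \<in> C"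
      using constacyclic_sequence_window_mem[OF n C lam c(1)] that by simp
    then have "vec_eval (schur_vec (vec n (\<lambda>j. ?s (j + k))) d) (x * y) = 0"
      using neg by blast
    then show ?thesis by (simp add: vec_eval_def schur_vec_def)
  qed
  \<comment> \<open>For each \<open>j\<close> the factor \<open>vec_eval c x\<close> is expanded
    along the window starting at \<open>j\<close>. After the sums are exchanged, the inner sum for
    each \<open>k\<close> is the value belonging to the \<open>k\<close>-th window, which is assumed
    to vanish.\<close>
  have "vec_eval c x * vec_eval d y =
      (\<Sum>j<n. (\<Sum>k<n. to_ac (?s (j + k)) * x ^ k) * x ^ j * (to_ac (d $ j) * y ^ j))"
    using constacyclic_sequence_sum[of c x lam] n x lam
    unfolding vec_eval_def[of d] dim by (simp add: sum_distrib_left)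
  also have "\<dots> = (\<Sum>j<n. \<Sum>k<n. x ^ k * (to_ac (?s (j + k)) * to_ac (d $ j) * (x * y) ^ j))"
    by (simp add: sum_distrib_right sum_distrib_left power_mult_distrib mult_ac)
  also have "\<dots> = (\<Sum>k<n. x ^ k * (\<Sum>j<n. to_ac (?s (j + k)) * to_ac (d $ j) * (x * y) ^ j))"
    by (subst sum.swap) (simp add: sum_distrib_left)
  also have "\<dots> = 0" using zero by simp
  finally show False using c d by simp
qed

section \<open>Fourier inversion and the convolution formula\<close>

lemma primitive_root_of_unity_power_inj:
  fixes \<xi> :: "'a::field"
  assumes \<xi>: "primitive_root_of_unity n \<xi>" and "i < n" "j < n" and "\<xi> ^ i = \<xi> ^ j"
  shows "i = j"
proof -
  have nz: "\<xi> \<noteq> 0"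
    using \<xi> \<open>i < n\<close> by (auto simp: primitive_root_of_unity_def power_0_left)
  have "\<not> i < j" if "i < n" "j < n" "\<xi> ^ i = \<xi> ^ j" for i j
  proof
    assume "i < j"
    then have "\<xi> ^ i * \<xi> ^ (j - i) = \<xi> ^ j" by (simp flip: power_add)
    then have "\<xi> ^ i * \<xi> ^ (j - i) = \<xi> ^ i * 1" using that(3) by simp
    then have "\<xi> ^ (j - i) = 1" using nz by simp
    then show False
      using \<xi> \<open>i < j\<close> that(2) by (auto simp: primitive_root_of_unity_def)
  qed
  from this[of i j] this[of j i] assms(2-4) show ?thesis by force
qed

text \<open>Orthogonality of characters: the sum is geometric with ratio
  \<open>z = \<xi> ^ m / \<xi> ^ j\<close>. From \<open>z ^ n = 1\<close> the product of
  \<open>z - 1\<close> and the sum is zero, and \<open>z = 1\<close> only for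
  \<open>m = j\<close>.\<close>

lemma sum_powers_primitive_root_of_unity:
  fixes \<xi> :: "'a::field"
  assumes \<xi>: "primitive_root_of_unity n \<xi>" and m: "m < n" "j < n"
  shows "(\<Sum>a<n. (\<xi> ^ a) ^ m * inverse (\<xi> ^ a) ^ j) = (if m = j then of_nat n else 0)"
proof -
  have one: "\<xi> ^ n = 1" using \<xi> by (simp add: primitive_root_of_unity_def)
  have nz: "\<xi> \<noteq> 0" using one m by (auto simp: power_0_left)
  define z where "z = \<xi> ^ m / \<xi> ^ j"
  have "(\<xi> ^ a) ^ m * inverse (\<xi> ^ a) ^ j = z ^ a" for a
    unfolding z_def divide_inverse power_mult_distrib power_inverse
    by (simp add: mult.commute flip: power_mult)
  then have sum: "(\<Sum>a<n. (\<xi> ^ a) ^ m * inverse (\<xi> ^ a) ^ j) = (\<Sum>a<n. z ^ a)" by simp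
  have "(\<xi> ^ k) ^ n = 1" for k using one by (metis power_mult mult.commute power_one)
  then have "z ^ n = 1" by (simp add: z_def power_divide)
  then have "(z - 1) * (\<Sum>a<n. z ^ a) = 0" using power_diff_1_eq[of z n] by simp
  moreover have "z = 1 \<longleftrightarrow> m = j"
    using nz primitive_root_of_unity_power_inj[OF \<xi> m] by (auto simp: z_def)
  ultimately show ?thesis using sum by auto
qed

text \<open>After the sums are exchanged, orthogonality leaves only the term \<open>m = j\<close>.
  The factor \<open>n\<close> stays on the left; that it is nonzero enters in the final
  theorem.\<close>

lemma vec_eval_inversion:
  assumes \<xi>: "primitive_root_of_unity n \<xi>" and c: "c \<in> carrier_vec n" and j: "j < n" and "\<beta> \<noteq> 0"
  shows "of_nat n * to_ac (c $ j) = (\<Sum>a<n. vec_eval c (\<xi> ^ a * \<beta>) * inverse (\<xi> ^ a * \<beta>) ^ j)"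
proof -
  have "(\<Sum>a<n. vec_eval c (\<xi> ^ a * \<beta>) * inverse (\<xi> ^ a * \<beta>) ^ j) =
      (\<Sum>m<n. \<Sum>a<n. to_ac (c $ m) * (\<xi> ^ a * \<beta>) ^ m * inverse (\<xi> ^ a * \<beta>) ^ j)"
    using c by (subst sum.swap) (simp add: vec_eval_def sum_distrib_right)
  also have "\<dots> = (\<Sum>m<n. to_ac (c $ m) * \<beta> ^ m * inverse \<beta> ^ j *
      (\<Sum>a<n. (\<xi> ^ a) ^ m * inverse (\<xi> ^ a) ^ j))"
    by (simp add: sum_distrib_left power_mult_distrib mult_ac)
  also have "\<dots> = (\<Sum>m<n. if m = j then to_ac (c $ m) * \<beta> ^ m * inverse \<beta> ^ j * of_nat n else 0)"
    using sum_powers_primitive_root_of_unity[OF \<xi> _ j] by (intro sum.cong) auto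
  also have "\<dots> = of_nat n * to_ac (c $ j)"
    using j \<open>\<beta> \<noteq> 0\<close> by (simp add: power_inverse)
  finally show ?thesis ..
qed

text \<open>Expanding each \<open>c $ j\<close> by inversion moves the factor
  \<open>inverse (\<xi> ^ a * \<beta>) ^ j\<close> into the argument of \<open>d\<close>.
  Componentwise multiplication thereby becomes a convolution of values.\<close>

lemma vec_eval_schur_vec:
  assumes \<xi>: "primitive_root_of_unity n \<xi>" and c: "c \<in> carrier_vec n" and d: "d \<in> carrier_vec n"
    and "\<beta> \<noteq> 0"
  shows "of_nat n * vec_eval (schur_vec c d) x =
    (\<Sum>a<n. vec_eval c (\<xi> ^ a * \<beta>) * vec_eval d (x / (\<xi> ^ a * \<beta>)))"
proof -
  have "of_nat n * vec_eval (schur_vec c d) x =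
      (\<Sum>j<n. (of_nat n * to_ac (c $ j)) * (to_ac (d $ j) * x ^ j))"
    using c d by (simp add: vec_eval_def schur_vec_def sum_distrib_left mult_ac)
  also have "\<dots> = (\<Sum>j<n. \<Sum>a<n. vec_eval c (\<xi> ^ a * \<beta>) *
      (to_ac (d $ j) * (x / (\<xi> ^ a * \<beta>)) ^ j))"
    using vec_eval_inversion[OF \<xi> c _ \<open>\<beta> \<noteq> 0\<close>]
    by (simp add: sum_distrib_left power_mult_distrib divide_inverse mult_ac)
  also have "\<dots> = (\<Sum>a<n. vec_eval c (\<xi> ^ a * \<beta>) * vec_eval d (x / (\<xi> ^ a * \<beta>)))"
    using d by (subst sum.swap) (simp add: vec_eval_def sum_distrib_left)
  finally show ?thesis .
qed

section \<open>The Schur product of two codes\<close>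

lemma schur_code_closed:
  fixes C D :: "'a::field vec set"
  assumes "C \<subseteq> carrier_vec n"
  shows "schur_code n C D \<subseteq> carrier_vec n"
    and "\<And>c d. c \<in> C \<Longrightarrow> d \<in> D \<Longrightarrow> schur_vec c d \<in> schur_code n C D"
    and "0\<^sub>v n \<in> schur_code n C D"
    and "\<And>u v. u \<in> schur_code n C D \<Longrightarrow> v \<in> schur_code n C D \<Longrightarrow> u + v \<in> schur_code n C D"
    and "\<And>a v. v \<in> schur_code n C D \<Longrightarrow> a \<cdot>\<^sub>v v \<in> schur_code n C D"
proof -
  interpret vec_space "TYPE('a)" n .
  let ?S = "{schur_vec c d | c d. c \<in> C \<and> d \<in> D}"
  have sub: "?S \<subseteq> carrier_vec n" using assms by auto
  have span: "schur_code n C D = span ?S" by (simp add: schur_code_def)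
  interpret S: LinearCombinations.submodule class_ring "span ?S" V
    using span_is_submodule[OF sub] .
  show "schur_code n C D \<subseteq> carrier_vec n" "0\<^sub>v n \<in> schur_code n C D"
    using S.subset S.zero_closed by (simp_all add: span)
  show "schur_vec c d \<in> schur_code n C D" if "c \<in> C" "d \<in> D" for c d
    using span_mem[OF sub] that unfolding span by blast
  show "u + v \<in> schur_code n C D" if "u \<in> schur_code n C D" "v \<in> schur_code n C D" for u v
    using S.m_closed that by (simp add: span)
  show "a \<cdot>\<^sub>v v \<in> schur_code n C D" if "v \<in> schur_code n C D" for a v
    using S.smult_closed that by (simp add: span)
qed

text \<open>The span is the least subspace containing the products. This serves as an induction
  principle, with \<open>S\<close> the set of vectors having the desired property.\<close>

lemma schur_code_subsetI:
  fixes C D :: "'a::field vec set"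
  assumes "S \<subseteq> carrier_vec n" "0\<^sub>v n \<in> S"
    and "\<And>u v. u \<in> S \<Longrightarrow> v \<in> S \<Longrightarrow> u + v \<in> S"
    and "\<And>a v. v \<in> S \<Longrightarrow> a \<cdot>\<^sub>v v \<in> S"
    and "\<And>c d. c \<in> C \<Longrightarrow> d \<in> D \<Longrightarrow> schur_vec c d \<in> S"
  shows "schur_code n C D \<subseteq> S"
proof -
  interpret vec_space "TYPE('a)" n .
  have "LinearCombinations.submodule class_ring S V"
    using assms vec_module by (intro LinearCombinations.submodule.intro) auto
  then show ?thesis
    unfolding schur_code_def using assms(5) by (intro span_is_subset) auto
qed

lemma constacyclic_shift_add:
  "dim_vec u = n \<Longrightarrow> dim_vec v = n \<Longrightarrow> n > 0 \<Longrightarrow>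
    constacyclic_shift lam (u + v) = constacyclic_shift lam u + constacyclic_shift lam v"
  by (intro eq_vecI) (auto simp: constacyclic_shift_def algebra_simps)

lemma constacyclic_shift_smult:
  "dim_vec v = n \<Longrightarrow> n > 0 \<Longrightarrow> constacyclic_shift lam (a \<cdot>\<^sub>v v) = a \<cdot>\<^sub>v constacyclic_shift lam v"
  by (intro eq_vecI) (auto simp: constacyclic_shift_def algebra_simps)

text \<open>At index 0 the factors \<open>lam\<close> and \<open>mu\<close> of the wrapped entries
  multiply; elsewhere both shifts merely move entries.\<close>

lemma constacyclic_shift_schur_vec:
  "dim_vec c = n \<Longrightarrow> dim_vec d = n \<Longrightarrow> n > 0 \<Longrightarrow>
    constacyclic_shift (lam * mu) (schur_vec c d) =
      schur_vec (constacyclic_shift lam c) (constacyclic_shift mu d)"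
  by (intro eq_vecI) (auto simp: constacyclic_shift_def schur_vec_def algebra_simps)

lemma constacyclic_code_schur_code:
  fixes lam mu :: "'a::field"
  assumes n: "n > 0" and C: "constacyclic_code n lam C" and D: "constacyclic_code n mu D"
  shows "constacyclic_code n (lam * mu) (schur_code n C D)"
proof -
  note C' = constacyclic_code_iff[OF n, THEN iffD1, OF C]
  note D' = constacyclic_code_iff[OF n, THEN iffD1, OF D]
  have sub: "C \<subseteq> carrier_vec n" using C' by simp
  note closed = schur_code_closed[OF sub, where D = D]
  \<comment> \<open>The shift is linear, so the vectors with shift in the product code form a
    subspace; it contains the spanning products because the shift of a product is a product of
    shifts.\<close>
  let ?S = "{v \<in> carrier_vec n. constacyclic_shift (lam * mu) v \<in> schur_code n C D}"
  have "schur_code n C D \<subseteq> ?S"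
  proof (rule schur_code_subsetI)
    have "constacyclic_shift (lam * mu) (0\<^sub>v n) = 0\<^sub>v n"
      using n by (intro eq_vecI) (auto simp: constacyclic_shift_def)
    then show "0\<^sub>v n \<in> ?S" using closed(3) by simp
    show "u + v \<in> ?S" if "u \<in> ?S" "v \<in> ?S" for u v
      using that n closed(4) by (simp add: constacyclic_shift_add[of _ n])
    show "a \<cdot>\<^sub>v v \<in> ?S" if "v \<in> ?S" for a v
      using that n closed(5) by (simp add: constacyclic_shift_smult[of _ n])
    show "schur_vec c d \<in> ?S" if cd: "c \<in> C" "d \<in> D" for c d
    proof -
      have "c \<in> carrier_vec n" "d \<in> carrier_vec n" using C' D' cd by auto
      then show ?thesis
        using constacyclic_shift_schur_vec[of c n d lam mu] n C' D' cd closed(2) by simp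
    qed
  qed auto
  then have "\<forall>v\<in>schur_code n C D. constacyclic_shift (lam * mu) v \<in> schur_code n C D" by auto
  then show ?thesis
    unfolding constacyclic_code_iff[OF n] using closed by simp
qed

text \<open>Evaluation at \<open>x\<close> is linear over the base field, so if it vanishes on all
  the products, it vanishes on their span.\<close>

lemma schur_code_vec_eval_nonzero_iff:
  fixes C D :: "'a::field vec set"
  assumes C: "C \<subseteq> carrier_vec n" and D: "D \<subseteq> carrier_vec n"
  shows "(\<exists>v\<in>schur_code n C D. vec_eval v x \<noteq> 0) \<longleftrightarrow>
    (\<exists>c\<in>C. \<exists>d\<in>D. vec_eval (schur_vec c d) x \<noteq> 0)"
proof
  show "\<exists>v\<in>schur_code n C D. vec_eval v x \<noteq> 0"
    if "\<exists>c\<in>C. \<exists>d\<in>D. vec_eval (schur_vec c d) x \<noteq> 0"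
    using that schur_code_closed(2)[OF C] by blast
  show "\<exists>c\<in>C. \<exists>d\<in>D. vec_eval (schur_vec c d) x \<noteq> 0"
    if "\<exists>v\<in>schur_code n C D. vec_eval v x \<noteq> 0"
  proof (rule ccontr)
    assume "\<not> ?thesis"
    then have "schur_code n C D \<subseteq> {v \<in> carrier_vec n. vec_eval v x = 0}"
      using C by (intro schur_code_subsetI) (auto simp: vec_eval_add vec_eval_smult)
    then show False using that by auto
  qed
qed

section \<open>Invertibility of the length, index sums modulo \<open>n\<close>, and the sumset
  formula\<close>

lemma of_nat_coprime_CARD_neq_0:
  assumes "coprime n CARD('a::{finite,field})"
  shows "(of_nat n :: 'a alg_closure) \<noteq> 0"
proof
  assume "(of_nat n :: 'a alg_closure) = 0"
  then have "CHAR('a) dvd n"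
    by (simp add: of_nat_eq_0_iff_char_dvd)
  \<comment> \<open>The characteristic also divides the cardinality of the field, which is coprime
    to \<open>n\<close>.\<close>
  then have "CHAR('a) dvd 1"
    using assms CHAR_dvd_CARD[where 'a = 'a] by (metis coprime_common_divisor)
  then show False by simp
qed

text \<open>For given \<open>i\<close> and \<open>a\<close> the second summand must be
  \<open>i - a\<close> modulo \<open>n\<close>. Adding \<open>n\<close> first keeps the subtraction
  of natural numbers from truncating, as \<open>a < n\<close>.\<close>

lemma sumset_mod_mem_iff:
  assumes "A \<subseteq> {..<n}" "B \<subseteq> {..<n}" "i < n"
  shows "i \<in> sumset_mod n A B \<longleftrightarrow> (\<exists>a\<in>A. (i + n - a) mod n \<in> B)"
proof
  assume "i \<in> sumset_mod n A B"
  then obtain a b where ab: "a \<in> A" "b \<in> B" "i = (a + b) mod n" by (auto simp: sumset_mod_def)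
  then have "a < n" "b < n" using assms by auto
  have "(i + n - a) mod n = b"
  proof (cases "a + b < n")
    case True
    then show ?thesis using ab \<open>b < n\<close> by simp
  next
    case False
    then have "i = a + b - n" using ab(3) \<open>a < n\<close> \<open>b < n\<close> by (simp add: mod_if)
    then show ?thesis using False \<open>b < n\<close> by simp
  qed
  then show "\<exists>a\<in>A. (i + n - a) mod n \<in> B" using ab by (intro bexI[of _ a]) simp_all
next
  assume "\<exists>a\<in>A. (i + n - a) mod n \<in> B"
  then obtain a where a: "a \<in> A" "(i + n - a) mod n \<in> B" by auto
  then have "a < n" using assms by auto
  then have "(a + (i + n - a) mod n) mod n = i"
    using assms(3) by (simp add: mod_add_right_eq)
  then show "i \<in> sumset_mod n A B" using a unfolding sumset_mod_def by force
qed

theorem theorem13: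
  fixes n :: nat
    and \<xi> \<beta>\<^sub>1 \<beta>\<^sub>2 :: "'a::{finite,field} alg_closure"
    and lam\<^sub>1 lam\<^sub>2 :: 'a
    and C\<^sub>1 C\<^sub>2 :: "'a vec set"
  assumes "n > 0"
    and "coprime n CARD('a)"
    and "primitive_root_of_unity n \<xi>"
    and "\<beta>\<^sub>1 ^ n = to_ac lam\<^sub>1" and "lam\<^sub>1 \<noteq> 0"
    and "\<beta>\<^sub>2 ^ n = to_ac lam\<^sub>2" and "lam\<^sub>2 \<noteq> 0"
    and "constacyclic_code n lam\<^sub>1 C\<^sub>1"
    and "constacyclic_code n lam\<^sub>2 C\<^sub>2"
  shows "constacyclic_code n (lam\<^sub>1 * lam\<^sub>2) (schur_code n C\<^sub>1 C\<^sub>2) \<and>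
    complete_generating_set n (lam\<^sub>1 * lam\<^sub>2) \<xi> (\<beta>\<^sub>1 * \<beta>\<^sub>2) (schur_code n C\<^sub>1 C\<^sub>2) =
      sumset_mod n (complete_generating_set n lam\<^sub>1 \<xi> \<beta>\<^sub>1 C\<^sub>1) (complete_generating_set n lam\<^sub>2 \<xi> \<beta>\<^sub>2 C\<^sub>2)"
proof
  note n = assms(1) and \<xi> = assms(3)
  let ?C = "schur_code n C\<^sub>1 C\<^sub>2"
  let ?G = "complete_generating_set n (lam\<^sub>1 * lam\<^sub>2) \<xi> (\<beta>\<^sub>1 * \<beta>\<^sub>2) ?C"
  let ?G1 = "complete_generating_set n lam\<^sub>1 \<xi> \<beta>\<^sub>1 C\<^sub>1"
  let ?G2 = "complete_generating_set n lam\<^sub>2 \<xi> \<beta>\<^sub>2 C\<^sub>2"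
  show code: "constacyclic_code n (lam\<^sub>1 * lam\<^sub>2) ?C"
    by (rule constacyclic_code_schur_code) (use assms in auto)
  have \<xi>_n: "\<xi> ^ n = 1" using \<xi> by (simp add: primitive_root_of_unity_def)
  have \<xi>_mod: "\<xi> ^ (k mod n) = \<xi> ^ k" for k
  proof -
    have "\<xi> ^ k = (\<xi> ^ n) ^ (k div n) * \<xi> ^ (k mod n)"
      by (simp flip: power_mult power_add)
    then show ?thesis by (simp add: \<xi>_n)
  qed
  have \<xi>_root: "(\<xi> ^ a * \<beta>\<^sub>1) ^ n = to_ac lam\<^sub>1" for a
  proof -
    have "(\<xi> ^ a) ^ n = 1" using \<xi>_n by (metis power_mult mult.commute power_one)
    then show ?thesis using assms(4) by (simp add: power_mult_distrib)
  qed
  have nz: "\<xi> \<noteq> 0" "\<beta>\<^sub>1 \<noteq> 0"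
    using \<xi>_n n assms(4,5) by (auto simp: power_0_left)
  have sub: "C\<^sub>1 \<subseteq> carrier_vec n" "C\<^sub>2 \<subseteq> carrier_vec n"
    using assms by (auto simp: constacyclic_code_def)
  have G1: "?G1 = {i. i < n \<and> (\<exists>c\<in>C\<^sub>1. vec_eval c (\<xi> ^ i * \<beta>\<^sub>1) \<noteq> 0)}"
    by (rule complete_generating_set_eq) (use assms \<xi>_n in auto)
  have G2: "?G2 = {i. i < n \<and> (\<exists>c\<in>C\<^sub>2. vec_eval c (\<xi> ^ i * \<beta>\<^sub>2) \<noteq> 0)}"
    by (rule complete_generating_set_eq) (use assms \<xi>_n in auto)
  have "?G = {i. i < n \<and> (\<exists>c\<in>?C. vec_eval c (\<xi> ^ i * (\<beta>\<^sub>1 * \<beta>\<^sub>2)) \<noteq> 0)}"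
    by (rule complete_generating_set_eq) (use assms \<xi>_n code in \<open>auto simp: power_mult_distrib\<close>)
  then have G: "?G = {i. i < n \<and>
      (\<exists>c\<in>C\<^sub>1. \<exists>d\<in>C\<^sub>2. vec_eval (schur_vec c d) (\<xi> ^ i * (\<beta>\<^sub>1 * \<beta>\<^sub>2)) \<noteq> 0)}"
    by (simp add: schur_code_vec_eval_nonzero_iff[OF sub])
  \<comment> \<open>The argument of \<open>d\<close> in the convolution formula is again one of the
    points that define \<open>?G2\<close>, namely the one with index \<open>i - a\<close> modulo
    \<open>n\<close>.\<close>
  have quotient: "\<xi> ^ i * (\<beta>\<^sub>1 * \<beta>\<^sub>2) / (\<xi> ^ a * \<beta>\<^sub>1) = \<xi> ^ ((i + n - a) mod n) * \<beta>\<^sub>2"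
    if "a < n" for i a
  proof -
    have "\<xi> ^ (i + n - a) * \<xi> ^ a = \<xi> ^ i"
      using that \<xi>_n by (simp flip: power_add) (simp add: power_add)
    then show ?thesis using nz by (simp add: \<xi>_mod divide_simps mult_ac)
  qed
  have "i \<in> ?G \<longleftrightarrow> (\<exists>a\<in>?G1. (i + n - a) mod n \<in> ?G2)" if i: "i < n" for i
  proof
    assume "i \<in> ?G"
    then obtain c d where cd: "c \<in> C\<^sub>1" "d \<in> C\<^sub>2"
      and "vec_eval (schur_vec c d) (\<xi> ^ i * (\<beta>\<^sub>1 * \<beta>\<^sub>2)) \<noteq> 0"
      unfolding G by auto
    moreover have carrier: "c \<in> carrier_vec n" "d \<in> carrier_vec n" using cd sub by auto
    ultimately have "of_nat n * vec_eval (schur_vec c d) (\<xi> ^ i * (\<beta>\<^sub>1 * \<beta>\<^sub>2)) \<noteq> 0"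
      using of_nat_coprime_CARD_neq_0[OF assms(2)] by simp
    \<comment> \<open>A nonzero convolution has a nonzero term; its index \<open>a\<close> lies in
      \<open>?G1\<close>, and the complementary index lies in \<open>?G2\<close>.\<close>
    then have "(\<Sum>a<n. vec_eval c (\<xi> ^ a * \<beta>\<^sub>1) *
        vec_eval d (\<xi> ^ i * (\<beta>\<^sub>1 * \<beta>\<^sub>2) / (\<xi> ^ a * \<beta>\<^sub>1))) \<noteq> 0"
      unfolding vec_eval_schur_vec[OF \<xi> carrier nz(2)] .
    then obtain a where "a \<in> {..<n}" and nonzero: "vec_eval c (\<xi> ^ a * \<beta>\<^sub>1) *
        vec_eval d (\<xi> ^ i * (\<beta>\<^sub>1 * \<beta>\<^sub>2) / (\<xi> ^ a * \<beta>\<^sub>1)) \<noteq> 0"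
      by (rule sum.not_neutral_contains_not_neutral)
    then have a: "a < n" by simp
    have "vec_eval c (\<xi> ^ a * \<beta>\<^sub>1) \<noteq> 0"
      and "vec_eval d (\<xi> ^ ((i + n - a) mod n) * \<beta>\<^sub>2) \<noteq> 0"
      using nonzero unfolding quotient[OF a] mult_eq_0_iff by blast+
    then have "a \<in> ?G1" "(i + n - a) mod n \<in> ?G2"
      unfolding G1 G2 using cd a n mod_less_divisor[of n] by blast+
    then show "\<exists>a\<in>?G1. (i + n - a) mod n \<in> ?G2" by blast
  next
    assume "\<exists>a\<in>?G1. (i + n - a) mod n \<in> ?G2"
    then obtain a where "a \<in> ?G1" and b: "(i + n - a) mod n \<in> ?G2" by blast
    then obtain c where a: "a < n" and c: "c \<in> C\<^sub>1" "vec_eval c (\<xi> ^ a * \<beta>\<^sub>1) \<noteq> 0"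
      unfolding G1 by blast
    from b obtain d where d: "d \<in> C\<^sub>2"
      "vec_eval d (\<xi> ^ i * (\<beta>\<^sub>1 * \<beta>\<^sub>2) / (\<xi> ^ a * \<beta>\<^sub>1)) \<noteq> 0"
      unfolding G2 quotient[OF a] by blast
    have "d \<in> carrier_vec n" using d(1) sub by auto
    \<comment> \<open>The lemma is used with \<open>x = \<xi> ^ a * \<beta>\<^sub>1\<close> and with
      the quotient as \<open>y\<close>, so that \<open>x * y\<close> is the point of index
      \<open>i\<close>. The codeword \<open>c\<close> may be replaced by another element
      \<open>e\<close> of the first code, while \<open>d\<close> stays.\<close>
    note ex = ex_schur_vec_eval_nonzero[OF n assms(8,5) \<xi>_root c this d(2)]
    have "\<xi> ^ a * \<beta>\<^sub>1 \<noteq> 0" using nz by simp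
    then have "\<xi> ^ a * \<beta>\<^sub>1 * (\<xi> ^ i * (\<beta>\<^sub>1 * \<beta>\<^sub>2) / (\<xi> ^ a * \<beta>\<^sub>1)) = \<xi> ^ i * (\<beta>\<^sub>1 * \<beta>\<^sub>2)"
      unfolding times_divide_eq_right by (rule nonzero_mult_div_cancel_left)
    from ex[unfolded this] obtain e
      where "e \<in> C\<^sub>1" "vec_eval (schur_vec e d) (\<xi> ^ i * (\<beta>\<^sub>1 * \<beta>\<^sub>2)) \<noteq> 0"
      by (rule bexE)
    then show "i \<in> ?G" unfolding G using d(1) i by blast
  qed
  moreover have sub1: "?G1 \<subseteq> {..<n}" and sub2: "?G2 \<subseteq> {..<n}"
    unfolding G1 G2 by blast+
  ultimately have "i \<in> ?G \<longleftrightarrow> i \<in> sumset_mod n ?G1 ?G2" if "i < n" for i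
    using that by (simp only: sumset_mod_mem_iff[OF sub1 sub2 that])
  moreover have "i < n" if "i \<in> ?G" for i using that unfolding G by blast
  moreover have "i < n" if "i \<in> sumset_mod n ?G1 ?G2" for i
    using that n unfolding sumset_mod_def by (elim CollectE exE conjE) simp
  ultimately show "?G = sumset_mod n ?G1 ?G2"
    by (intro equalityI subsetI) metis+
qed

end
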